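(* Let $c\in\mathbb{R}^n$, $b\in\mathbb{R}$, and let $U\subseteq\mathbb{R}^n$ be non-empty, compact and convex. Consider the robust problem $\mathbf{RO}(U)$: $\inf_{x\in\mathbb{R}^n}\langle c,x\rangle$ subject to $\langle a,x\rangle\ge b$ for all $a\in U$. Suppose that: 1. $\mathbf{RO}(U)$ satisfies the strong Slater condition with strong Slater constant $\rho>0$, i.e. there is $x_0\in\mathbb{R}^n$ with $\langle a,x_0\rangle\ge b+\rho$ for all $a\in U$; 2. the optimal solution set $F^{\mathrm{opt}}(\mathbf{RO}(U))$ is non-empty and bounded. Let $T:=\mathbb{R}^n$. Then the linear semi-infinite problem $\pi_U:=(c,\sigma_U)$ indexed by $T$, where $$\sigma_U(t):=\begin{cases}(t,b)&\text{if }t\in U,\\(0_n,-\rho)&\text{if }t\notin U,\end{cases}$$ belongs to $\mathrm{int}(\Pi_s)$, and for any $\epsilon$ satisfying $0<\epsilon<\delta^{\Pi}(\pi_U,\mathrm{bd}(\Pi_s))$ and for all compact, convex $V\subseteq\mathbb{R}^n$ satisfying $d_H(U,V)<\epsilon$, $$|\nu(\mathbf{RO}(U))-\nu(\mathbf{RO}(V))|\le L(U,\epsilon)\,d_H(U,V),$$ where $\mathbf{RO}(V)$ has the same $c$ and $b$ as $\mathbf{RO}(U)$, and $L(U,\epsilon):=L(\pi_U,\epsilon)$ is the explicit constant defined in the context.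
   Context: $\|\cdot\|$ is the Euclidean norm, $\langle\cdot,\cdot\rangle$ the dot product, $0_n$ the zero vector of $\mathbb{R}^n$. Distances from a point to a set are infima of distances to its elements ($\inf\varnothing=+\infty$). Robust problems: for an uncertainty set $U\subseteq\mathbb{R}^n$ (with $c,b$ fixed), $\nu(\mathbf{RO}(U))$ is the optimal value and $F^{\mathrm{opt}}(\mathbf{RO}(U))$ the set of optimal solutions. $d_H(U,V):=\max\{\sup_{u\in U}\inf_{v\in V}\|u-v\|,\ \sup_{v\in V}\inf_{u\in U}\|u-v\|\}$ is the Hausdorff distance. Linear semi-infinite (LSIO) problems: for an index set $T$ (no structure assumed), a constraint system is $\sigma=(a,b)$ with $a:T\to\mathbb{R}^n$, $b:T\to\mathbb{R}$, written $\sigma(t)=(a_t,b_t)\in\mathbb{R}^{n+1}$; $\Sigma:=(\mathbb{R}^n\times\mathbb{R})^T$ is the set of all constraint systems. An LSIO problem is $\pi=(c,\sigma)\in\Pi:=\mathbb{R}^n\times\Sigma$, representing $\inf_x\langle c,x\rangle$ subject to $\langle a_t,x\rangle\ge b_t$ for all $t\in T$. Put $F(\sigma):=\{x:\langle a_t,x\rangle\ge b_t\ \forall t\in T\}$, $\nu(\pi):=\inf\{\langle c,x\rangle:x\in F(\sigma)\}$ ($+\infty$ if $F(\sigma)=\varnothing$), $F^{\mathrm{opt}}(\pi):=\{x\in F(\sigma):\langle c,x\rangle=\nu(\pi)\}$. Define $\delta^{\Sigma}(\sigma_1,\sigma_2):=\sup_{t\in T}\|(a^1_t,b^1_t)-(a^2_t,b^2_t)\|$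 and $\delta^{\Pi}(\pi_1,\pi_2):=\max\{\|c^1-c^2\|,\delta^{\Sigma}(\sigma_1,\sigma_2)\}$ (values may be $+\infty$). Interior ($\mathrm{int}$) and boundary ($\mathrm{bd}$) in $\Sigma$, $\Pi$ are with respect to these. $\Sigma_i:=\{\sigma\in\Sigma:F(\sigma)=\varnothing\}$; $\Pi_s:=\{\pi\in\Pi:F^{\mathrm{opt}}(\pi)\ne\varnothing\}$. Constant $L$: for $\pi_0=(c^0,\sigma_0)\in\mathrm{int}(\Pi_s)$ with $\sigma_0=(a_t,b_t)_{t\in T}$ and $0<\epsilon<\delta^{\Pi}(\pi_0,\mathrm{bd}(\Pi_s))$, let $\varphi(\lambda)=\varphi_*(\lambda):=\sqrt{1+\lambda^2}$, $\psi(\alpha):=(1+\alpha)\sqrt{1+\alpha^2}$, $R(\pi_0):=\{-b_t:t\in T\}\cup\{\nu(\pi_0)\}$, $Z^-(\pi_0):=\mathrm{conv}(\{a_t:t\in T\}\cup\{-c^0\})$, and $$\widehat\rho(\pi_0):=\frac{\sup R(\pi_0)}{d_*(0_n,\mathrm{bd}(Z^-(\pi_0)))},\qquad \beta(\pi_0,\epsilon):=\frac{\psi(\widehat\rho(\pi_0))}{\delta^{\Sigma}(\sigma_0,\Sigma_i)-\epsilon},$$ $$\gamma(\pi_0,\epsilon):=\varphi_*(0)\big(\widehat\rho(\pi_0)+\epsilon\beta(\pi_0,\epsilon)\big)+\|c^0\|_*\beta(\pi_0,\epsilon),\qquad \mu(\pi_0,\epsilon):=\varphi(0)\frac{\sup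 R(\pi_0)+\epsilon\max\{1,\gamma(\pi_0,\epsilon)\}}{d(0_n,\mathrm{bd}(Z^-(\pi_0)))-\epsilon},$$ $$L(\pi_0,\epsilon):=\varphi_*(0)\left((\epsilon+\|c^0\|)\frac{\psi(\mu(\pi_0,\epsilon))}{\delta^{\Sigma}(\sigma_0,\Sigma_i)-\epsilon}+\mu(\pi_0,\epsilon)\right).$$ Here $d$ is Euclidean distance, and the dual norm $\|\cdot\|_*$ (with distance $d_*$) coincides with the Euclidean one. *)

theory Defs
  imports "HOL-Analysis.Analysis"
begin

text \<open>All distances, suprema and infima are taken in \<^typ>\<open>ereal\<close>, where the infimum over the
  empty set is \<^term>\<open>\<infinity> :: ereal\<close>.\<close>

definition edist :: "'a::metric_space \<Rightarrow> 'a \<Rightarrow> ereal" where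
  "edist x y = ereal (dist x y)"

definition dist_to :: "('a \<Rightarrow> 'a \<Rightarrow> ereal) \<Rightarrow> 'a \<Rightarrow> 'a set \<Rightarrow> ereal" where
  "dist_to d x S = (INF y\<in>S. d x y)"

definition hausdorff_distance :: "'a::metric_space set \<Rightarrow> 'a set \<Rightarrow> ereal" where
  "hausdorff_distance U V = max (SUP u\<in>U. dist_to edist u V) (SUP v\<in>V. dist_to edist v U)"

definition edist_topology :: "('a \<Rightarrow> 'a \<Rightarrow> ereal) \<Rightarrow> 'a topology" where
  "edist_topology d = topology (\<lambda>S. \<forall>x\<in>S. \<exists>e>0. \<forall>y. d x y < e \<longrightarrow> y \<in> S)"

lemma openin_edist_topology:
  "openin (edist_topology d) S \<longleftrightarrow> (\<forall>x\<in>S. \<exists>e>0. \<forall>y. d x y < e \<longrightarrow> y \<in> S)"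
proof -
  define L where "L = (\<lambda>S. \<forall>x\<in>S. \<exists>e>0. \<forall>y. d x y < e \<longrightarrow> y \<in> S)"
  have inter: "L (S \<inter> T)" if S: "L S" and T: "L T" for S T
    unfolding L_def
  proof
    fix x assume x: "x \<in> S \<inter> T"
    obtain e1 where e1: "e1 > 0" "\<forall>y. d x y < e1 \<longrightarrow> y \<in> S"
      using bspec[OF S[unfolded L_def] IntD1[OF x]] by (elim exE conjE)
    obtain e2 where e2: "e2 > 0" "\<forall>y. d x y < e2 \<longrightarrow> y \<in> T"
      using bspec[OF T[unfolded L_def] IntD2[OF x]] by (elim exE conjE)
    have "0 < min e1 e2 \<and> (\<forall>y. d x y < min e1 e2 \<longrightarrow> y \<in> S \<inter> T)"
      using e1 e2 by simp
    then show "\<exists>e>0. \<forall>y. d x y < e \<longrightarrow> y \<in> S \<inter> T" by (rule exI)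
  qed
  have union: "L (\<Union>K)" if K: "\<forall>S\<in>K. L S" for K
    unfolding L_def
  proof
    fix x assume "x \<in> \<Union>K"
    then obtain S where S: "S \<in> K" "x \<in> S" by (elim UnionE)
    obtain e where e: "e > 0" "\<forall>y. d x y < e \<longrightarrow> y \<in> S"
      using bspec[OF bspec[OF K S(1), unfolded L_def] S(2)] by (elim exE conjE)
    have "0 < e \<and> (\<forall>y. d x y < e \<longrightarrow> y \<in> \<Union>K)"
      using e S(1) by (simp, metis)
    then show "\<exists>e>0. \<forall>y. d x y < e \<longrightarrow> y \<in> \<Union>K" by (rule exI)
  qed
  have "istopology L"
    unfolding istopology_def using inter union by simp
  then have "openin (topology L) S = L S" by simp
  then show ?thesis unfolding edist_topology_def L_def .
qed

lemma topspace_edist_topology: "topspace (edist_topology d) = UNIV"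
proof (rule antisym)
  have "\<exists>e>0. \<forall>y. d x y < e \<longrightarrow> y \<in> UNIV" for x
    by (rule exI[of _ 1]) simp
  then have "openin (edist_topology d) UNIV"
    unfolding openin_edist_topology by simp
  then show "UNIV \<subseteq> topspace (edist_topology d)" by (rule openin_subset)
qed simp

definition RO_feasible :: "real \<Rightarrow> (real ^ 'n) set \<Rightarrow> (real ^ 'n) set" where
  "RO_feasible b U = {x. \<forall>a\<in>U. a \<bullet> x \<ge> b}"

definition RO_value :: "real ^ 'n \<Rightarrow> real \<Rightarrow> (real ^ 'n) set \<Rightarrow> ereal" where
  "RO_value c b U = (INF x\<in>RO_feasible b U. ereal (c \<bullet> x))"

definition RO_opt :: "real ^ 'n \<Rightarrow> real \<Rightarrow> (real ^ 'n) set \<Rightarrow> (real ^ 'n) set" where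
  "RO_opt c b U = {x \<in> RO_feasible b U. ereal (c \<bullet> x) = RO_value c b U}"

definition strong_Slater :: "real \<Rightarrow> (real ^ 'n) set \<Rightarrow> real \<Rightarrow> bool" where
  "strong_Slater b U \<rho> \<longleftrightarrow> \<rho> > 0 \<and> (\<exists>x0. \<forall>a\<in>U. a \<bullet> x0 \<ge> b + \<rho>)"

text \<open>The index set \<open>T\<close> is the type \<^typ>\<open>'t\<close>. The norm on \<^typ>\<open>(real ^ 'n) \<times> real\<close> is the Euclidean
  norm of \<open>\<real>\<^bsup>n+1\<^esup>\<close>.\<close>

type_synonym ('t, 'n) system = "'t \<Rightarrow> (real ^ 'n) \<times> real"
type_synonym ('t, 'n) lsio = "(real ^ 'n) \<times> ('t, 'n) system"

definition feasible :: "('t, 'n::finite) system \<Rightarrow> (real ^ 'n) set" where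
  "feasible \<sigma> = {x. \<forall>t. fst (\<sigma> t) \<bullet> x \<ge> snd (\<sigma> t)}"

definition opt_value :: "('t, 'n::finite) lsio \<Rightarrow> ereal" where
  "opt_value \<pi> = (INF x\<in>feasible (snd \<pi>). ereal (fst \<pi> \<bullet> x))"

definition opt_set :: "('t, 'n::finite) lsio \<Rightarrow> (real ^ 'n) set" where
  "opt_set \<pi> = {x \<in> feasible (snd \<pi>). ereal (fst \<pi> \<bullet> x) = opt_value \<pi>}"

definition delta_Sigma :: "('t, 'n::finite) system \<Rightarrow> ('t, 'n::finite) system \<Rightarrow> ereal" where
  "delta_Sigma \<sigma>1 \<sigma>2 = (SUP t. ereal (norm (\<sigma>1 t - \<sigma>2 t)))"

definition delta_Pi :: "('t, 'n::finite) lsio \<Rightarrow> ('t, 'n::finite) lsio \<Rightarrow> ereal" where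
  "delta_Pi \<pi>1 \<pi>2 = max (ereal (norm (fst \<pi>1 - fst \<pi>2))) (delta_Sigma (snd \<pi>1) (snd \<pi>2))"

abbreviation Pi_topology :: "('t, 'n::finite) lsio topology" where
  "Pi_topology \<equiv> edist_topology delta_Pi"

definition Sigma_i :: "('t, 'n::finite) system set" where
  "Sigma_i = {\<sigma>. feasible \<sigma> = {}}"

definition Pi_s :: "('t, 'n::finite) lsio set" where
  "Pi_s = {\<pi>. opt_set \<pi> \<noteq> {}}"

text \<open>The formulas are evaluated in \<^typ>\<open>ereal\<close>, since the suprema and distances that enter them
  may be infinite. The dual norm coincides with the Euclidean norm, so \<open>\<phi>\<^sub>* = \<phi>\<close>, \<open>d\<^sub>* = d\<close>.\<close>

definition sqrt_ereal :: "ereal \<Rightarrow> ereal" where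
  "sqrt_ereal x = (case x of ereal r \<Rightarrow> ereal (sqrt r) | PInfty \<Rightarrow> \<infinity> | MInfty \<Rightarrow> -\<infinity>)"

definition phi :: "ereal \<Rightarrow> ereal" where
  "phi s = sqrt_ereal (1 + s\<^sup>2)"

definition psi :: "ereal \<Rightarrow> ereal" where
  "psi \<alpha> = (1 + \<alpha>) * sqrt_ereal (1 + \<alpha>\<^sup>2)"

definition R_set :: "('t, 'n::finite) lsio \<Rightarrow> ereal set" where
  "R_set \<pi> = range (\<lambda>t. - ereal (snd (snd \<pi> t))) \<union> {opt_value \<pi>}"

definition Z_minus :: "('t, 'n::finite) lsio \<Rightarrow> (real ^ 'n) set" where
  "Z_minus \<pi> = convex hull (range (\<lambda>t. fst (snd \<pi> t)) \<union> {- fst \<pi>})"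

definition rho_hat :: "('t, 'n::finite) lsio \<Rightarrow> ereal" where
  "rho_hat \<pi> = Sup (R_set \<pi>) / dist_to edist 0 (frontier (Z_minus \<pi>))"

definition beta_const :: "('t, 'n::finite) lsio \<Rightarrow> real \<Rightarrow> ereal" where
  "beta_const \<pi> \<epsilon> = psi (rho_hat \<pi>) / (dist_to delta_Sigma (snd \<pi>) Sigma_i - ereal \<epsilon>)"

definition gamma_const :: "('t, 'n::finite) lsio \<Rightarrow> real \<Rightarrow> ereal" where
  "gamma_const \<pi> \<epsilon> =
     phi 0 * (rho_hat \<pi> + ereal \<epsilon> * beta_const \<pi> \<epsilon>) + ereal (norm (fst \<pi>)) * beta_const \<pi> \<epsilon>"

definition mu_const :: "('t, 'n::finite) lsio \<Rightarrow> real \<Rightarrow> ereal" where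
  "mu_const \<pi> \<epsilon> =
     phi 0 * ((Sup (R_set \<pi>) + ereal \<epsilon> * max 1 (gamma_const \<pi> \<epsilon>))
              / (dist_to edist 0 (frontier (Z_minus \<pi>)) - ereal \<epsilon>))"

definition L_const :: "('t, 'n::finite) lsio \<Rightarrow> real \<Rightarrow> ereal" where
  "L_const \<pi> \<epsilon> =
     phi 0 * ((ereal \<epsilon> + ereal (norm (fst \<pi>)))
                * (psi (mu_const \<pi> \<epsilon>) / (dist_to delta_Sigma (snd \<pi>) Sigma_i - ereal \<epsilon>))
              + mu_const \<pi> \<epsilon>)"

definition system_of :: "real \<Rightarrow> real \<Rightarrow> (real ^ 'n) set \<Rightarrow> (real ^ 'n, 'n::finite) system" where
  "system_of b \<rho> U = (\<lambda>t. if t \<in> U then (t, b) else (0, - \<rho>))"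

definition lsio_of :: "real ^ 'n \<Rightarrow> real \<Rightarrow> real \<Rightarrow> (real ^ 'n) set \<Rightarrow> (real ^ 'n, 'n::finite) lsio" where
  "lsio_of c b \<rho> U = (c, system_of b \<rho> U)"

end

theory Submission
  imports Defs
begin

text \<open>
  Write \<open>\<pi>\<close> for the problem attached to \<open>U\<close>, \<open>d\<close> for the distance from the origin to the boundary of
  \<open>Z_minus \<pi>\<close>, and \<open>D\<close> for the distance from its constraint system to \<open>Sigma_i\<close>. The argument rests
  on two quantitative facts, one for each of these distances.

  \<^emph>\<open>The distance \<open>d\<close> bounds solutions.\<close> If every generator \<open>g\<close> of a convex hull satisfies \<open>g \<bullet> x \<ge> - M\<close>,
  then so does every point of the hull, in particular the point of norm \<open>d\<close> opposite to \<open>x\<close>; hence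
  \<open>d * norm x \<le> M\<close> (\<open>norm_bound_from_inner_ball\<close>). The generators of \<open>Z_minus \<pi>\<close> are the constraint
  vectors and \<open>- c\<close>, so this bounds the feasible points of low cost.

  \<^emph>\<open>The distance \<open>D\<close> repairs violations.\<close> A violated constraint of a point \<open>x\<close> can be repaired
  by moving towards a point whose slack grows in proportion to its distance from \<open>x\<close>. By convex
  duality such a point exists unless some constraint vector is short and is not strictly satisfied by
  \<open>x\<close> (\<open>slack_proportional_to_distance\<close>). That single constraint could then be made contradictory by a
  perturbation smaller than \<open>D\<close>, which is impossible. Consequently a point that violates the
  constraints by at most \<open>h * norm x\<close> lies within \<open>h * norm x * sqrt (1 + (norm x)\<^sup>2) / (D - \<epsilon>)\<close> of a
  feasible point (\<open>feasible_point_near\<close>).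

  If the Hausdorff distance of \<open>U\<close> and \<open>V\<close> is \<open>h < \<epsilon>\<close>, a feasible point \<open>x\<close> for one of the two sets
  violates the constraints of the other by at most \<open>h * norm x\<close>. Repairing an optimal point for \<open>U\<close>
  bounds the value of \<open>V\<close> from above; repairing the points that are feasible for \<open>V\<close> and cheaper than the
  value of \<open>U\<close> bounds it from below. All these points have norm at most \<open>mu_const \<pi> \<epsilon>\<close>, which produces
  the constant.

  It remains to see that \<open>\<epsilon> < d\<close> and \<open>\<epsilon> < D\<close>. Making the system infeasible, or translating the generators
  so that the origin leaves \<open>Z_minus \<pi>\<close> and a descent direction appears, leads out of \<open>Pi_s\<close>. The segment
  from \<open>\<pi>\<close> to such a problem meets the boundary of \<open>Pi_s\<close>, so the distance to this boundary is at
  most \<open>D\<close> and at most \<open>d\<close>. Finally, \<open>\<pi>\<close> is interior to \<open>Pi_s\<close> because boundedness of the optimal set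
  puts the origin in the interior of \<open>Z_minus \<pi>\<close>; together with the Slater point this makes nearby problems
  feasible with bounded sublevel sets.
\<close>

section \<open>Boundedness of solutions\<close>

text \<open>The set may have empty interior, and \<open>z\<close> may lie inside it relative to its affine hull: then a
  normal vector of a hyperplane containing the set, with a suitable sign, does the job.\<close>

lemma supporting_functional_at_non_interior_point:
  fixes S :: "'a::euclidean_space set"
  assumes "convex S" "z \<notin> interior S"
  obtains y where "y \<noteq> 0" "\<And>x. x \<in> S \<Longrightarrow> y \<bullet> z \<le> y \<bullet> x"
proof (cases "interior S = {}")
  case True
  then obtain a \<beta> where a: "a \<noteq> 0" "S \<subseteq> {x. a \<bullet> x = \<beta>}"
    using empty_interior_subset_hyperplane[OF assms(1)] by metis
  then have eq: "a \<bullet> x = \<beta>" if "x \<in> S" for x using that by blast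
  show ?thesis
  proof (cases "a \<bullet> z \<le> \<beta>")
    case True
    with a(1) eq show ?thesis by (intro that[of a]) auto
  next
    case False
    with a(1) eq show ?thesis by (intro that[of "-a"]) auto
  qed
next
  case False
  have "convex {z}" by simp
  then obtain y \<beta> where y: "y \<noteq> 0" "\<And>x. x \<in> {z} \<Longrightarrow> y \<bullet> x \<le> \<beta>" "\<And>x. x \<in> interior S \<Longrightarrow> \<beta> \<le> y \<bullet> x"
    using separating_hyperplane_sets[of "{z}" "interior S"] assms False convex_interior by blast
  have "closure (interior S) \<subseteq> {x. y \<bullet> z \<le> y \<bullet> x}"
  proof (rule closure_minimal)
    show "interior S \<subseteq> {x. y \<bullet> z \<le> y \<bullet> x}"
      using y by force
    show "closed {x. y \<bullet> z \<le> y \<bullet> x}" by (intro closed_Collect_le continuous_intros)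
  qed
  then have "S \<subseteq> {x. y \<bullet> z \<le> y \<bullet> x}"
    using convex_closure_interior[OF assms(1) False] closure_subset by blast
  with y(1) that show ?thesis by blast
qed

text \<open>The half-space \<open>{z. - M \<le> z \<bullet> x}\<close> contains \<open>G\<close>, hence its convex hull, hence the point of the
  ball that is opposite to \<open>x\<close>; there the inner product is \<open>- r * norm x\<close>.\<close>

lemma norm_bound_from_inner_ball:
  fixes x :: "'a::real_inner"
  assumes ball: "cball 0 r \<subseteq> convex hull G" and "r \<ge> 0"
    and G: "\<And>g. g \<in> G \<Longrightarrow> - M \<le> g \<bullet> x"
  shows "r * norm x \<le> M"
proof -
  have "convex {z. - M \<le> z \<bullet> x}"
    using convex_halfspace_ge[of "-M" x] by (simp add: inner_commute)
  then have hull: "convex hull G \<subseteq> {z. - M \<le> z \<bullet> x}"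
    using G by (intro hull_minimal) auto
  define z where "z = - (r *\<^sub>R sgn x)"
  have "norm z \<le> r" using \<open>r \<ge> 0\<close> by (simp add: z_def norm_sgn)
  then have "- M \<le> z \<bullet> x" using ball hull by (auto simp: subset_iff)
  moreover have "z \<bullet> x = - (r * norm x)"
    by (cases "x = 0") (simp_all add: z_def sgn_div_norm power2_norm_eq_inner[symmetric] power2_eq_square field_simps)
  ultimately show ?thesis by simp
qed

text \<open>The feasible set is closed, so the sublevel set of \<open>x0\<close> is compact and the cost attains its
  minimum on it.\<close>

lemma opt_set_nonempty_if_sublevel_bounded:
  fixes \<pi> :: "('t, 'n::finite) lsio"
  assumes x0: "x0 \<in> feasible (snd \<pi>)"
    and bnd: "\<And>x. x \<in> feasible (snd \<pi>) \<Longrightarrow> fst \<pi> \<bullet> x \<le> fst \<pi> \<bullet> x0 \<Longrightarrow> norm x \<le> B"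
  shows "opt_set \<pi> \<noteq> {}"
proof -
  define C where "C = feasible (snd \<pi>) \<inter> {x. fst \<pi> \<bullet> x \<le> fst \<pi> \<bullet> x0}"
  have "closed (feasible (snd \<pi>))"
    unfolding feasible_def by (intro closed_Collect_all closed_Collect_le continuous_intros)
  moreover have "closed {x. fst \<pi> \<bullet> x \<le> fst \<pi> \<bullet> x0}"
    by (intro closed_Collect_le continuous_intros)
  moreover have "bounded C" using bnd unfolding C_def bounded_iff by blast
  ultimately have "compact C" unfolding C_def by (simp add: compact_eq_bounded_closed closed_Int)
  moreover have "x0 \<in> C" using x0 by (simp add: C_def)
  moreover have "continuous_on C ((\<bullet>) (fst \<pi>))" by (intro continuous_intros)
  ultimately obtain y where y: "y \<in> C" "\<And>x. x \<in> C \<Longrightarrow> fst \<pi> \<bullet> y \<le> fst \<pi> \<bullet> x"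
    using continuous_attains_inf[of C "(\<bullet>) (fst \<pi>)"] by blast
  have "opt_value \<pi> = ereal (fst \<pi> \<bullet> y)"
    unfolding opt_value_def
  proof (rule antisym)
    show "(INF x\<in>feasible (snd \<pi>). ereal (fst \<pi> \<bullet> x)) \<le> ereal (fst \<pi> \<bullet> y)"
      using y by (intro INF_lower) (auto simp: C_def)
    show "ereal (fst \<pi> \<bullet> y) \<le> (INF x\<in>feasible (snd \<pi>). ereal (fst \<pi> \<bullet> x))"
    proof (rule INF_greatest)
      fix x assume "x \<in> feasible (snd \<pi>)"
      then show "ereal (fst \<pi> \<bullet> y) \<le> ereal (fst \<pi> \<bullet> x)"
        using y(2)[of x] y(2)[OF \<open>x0 \<in> C\<close>] by (cases "x \<in> C") (auto simp: C_def)
    qed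
  qed
  then show ?thesis using y(1) by (auto simp: opt_set_def C_def)
qed

section \<open>The metric on the space of problems\<close>

lemma delta_Sigma_nonneg: "0 \<le> delta_Sigma \<sigma> \<sigma>'"
  unfolding delta_Sigma_def by (rule SUP_upper2[of undefined]) auto

lemma delta_Sigma_leI:
  "(\<And>t. norm (\<sigma> t - \<sigma>' t) \<le> r) \<Longrightarrow> delta_Sigma \<sigma> \<sigma>' \<le> ereal r"
  unfolding delta_Sigma_def by (rule SUP_least) simp

lemma norm_le_delta_Sigma: "ereal (norm (\<sigma> t - \<sigma>' t)) \<le> delta_Sigma \<sigma> \<sigma>'"
  unfolding delta_Sigma_def by (rule SUP_upper) simp

lemma delta_Sigma_triangle: "delta_Sigma \<sigma> \<sigma>'' \<le> delta_Sigma \<sigma> \<sigma>' + delta_Sigma \<sigma>' \<sigma>''"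
  unfolding delta_Sigma_def[of \<sigma> \<sigma>'']
proof (rule SUP_least)
  fix t
  have "ereal (norm (\<sigma> t - \<sigma>'' t)) \<le> ereal (norm (\<sigma> t - \<sigma>' t)) + ereal (norm (\<sigma>' t - \<sigma>'' t))"
    using norm_triangle_ineq[of "\<sigma> t - \<sigma>' t" "\<sigma>' t - \<sigma>'' t"] by simp
  also have "\<dots> \<le> delta_Sigma \<sigma> \<sigma>' + delta_Sigma \<sigma>' \<sigma>''"
    by (intro add_mono norm_le_delta_Sigma)
  finally show "ereal (norm (\<sigma> t - \<sigma>'' t)) \<le> \<dots>" .
qed

lemma delta_Pi_triangle: "delta_Pi \<pi> \<pi>'' \<le> delta_Pi \<pi> \<pi>' + delta_Pi \<pi>' \<pi>''"
proof -
  have "ereal (norm (fst \<pi> - fst \<pi>'')) \<le> ereal (norm (fst \<pi> - fst \<pi>')) + ereal (norm (fst \<pi>' - fst \<pi>''))"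
    using norm_triangle_ineq[of "fst \<pi> - fst \<pi>'" "fst \<pi>' - fst \<pi>''"] by simp
  also have "\<dots> \<le> delta_Pi \<pi> \<pi>' + delta_Pi \<pi>' \<pi>''"
    by (intro add_mono) (auto simp: delta_Pi_def)
  finally have 1: "ereal (norm (fst \<pi> - fst \<pi>'')) \<le> delta_Pi \<pi> \<pi>' + delta_Pi \<pi>' \<pi>''" .
  have "delta_Sigma (snd \<pi>) (snd \<pi>'') \<le> delta_Sigma (snd \<pi>) (snd \<pi>') + delta_Sigma (snd \<pi>') (snd \<pi>'')"
    by (rule delta_Sigma_triangle)
  also have "\<dots> \<le> delta_Pi \<pi> \<pi>' + delta_Pi \<pi>' \<pi>''"
    by (intro add_mono) (auto simp: delta_Pi_def)
  finally show ?thesis using 1 by (simp add: delta_Pi_def[of \<pi> \<pi>''])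
qed

lemma delta_Pi_self: "delta_Pi \<pi> \<pi> = 0"
  by (simp add: delta_Pi_def delta_Sigma_def zero_ereal_def)

lemma in_Pi_interiorI:
  assumes "0 < r" and ball: "\<And>\<pi>'. delta_Pi \<pi> \<pi>' < ereal r \<Longrightarrow> \<pi>' \<in> P"
  shows "\<pi> \<in> Pi_topology interior_of P"
proof -
  define O' where "O' = {\<pi>'. delta_Pi \<pi> \<pi>' < ereal r}"
  have "openin Pi_topology O'"
    unfolding openin_edist_topology
  proof
    fix \<pi>' assume "\<pi>' \<in> O'"
    then have less: "delta_Pi \<pi> \<pi>' < ereal r" by (simp add: O'_def)
    have "0 \<le> delta_Pi \<pi> \<pi>'" by (simp add: delta_Pi_def delta_Sigma_nonneg max.coboundedI1)
    with less obtain s where s: "delta_Pi \<pi> \<pi>' = ereal s" "s < r" by (cases "delta_Pi \<pi> \<pi>'") auto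
    have "\<pi>'' \<in> O'" if "delta_Pi \<pi>' \<pi>'' < ereal (r - s)" for \<pi>''
    proof -
      have "delta_Pi \<pi> \<pi>'' \<le> ereal s + delta_Pi \<pi>' \<pi>''"
        using delta_Pi_triangle[of \<pi> \<pi>'' \<pi>'] s by simp
      also have "\<dots> < ereal s + ereal (r - s)"
        using that by (intro ereal_less_add) auto
      finally show ?thesis by (simp add: O'_def)
    qed
    with s show "\<exists>e>0. \<forall>\<pi>''. delta_Pi \<pi>' \<pi>'' < e \<longrightarrow> \<pi>'' \<in> O'"
      by (intro exI[of _ "ereal (r - s)"]) auto
  qed
  moreover have "\<pi> \<in> O'" using \<open>0 < r\<close> by (simp add: O'_def delta_Pi_self)
  moreover have "O' \<subseteq> P" using ball by (auto simp: O'_def)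
  ultimately show ?thesis unfolding interior_of_def by blast
qed

text \<open>The segment from \<open>\<pi>\<close> to \<open>\<pi>'\<close> is a continuous curve for \<open>delta_Pi\<close> because
  this distance is finite; being connected, it meets the boundary of \<open>P\<close> at a point no
  farther from \<open>\<pi>\<close> than \<open>\<pi>'\<close> is.\<close>

lemma dist_to_frontier_le:
  fixes \<pi> \<pi>' :: "('t, 'n::finite) lsio"
  assumes "\<pi> \<in> P" "\<pi>' \<notin> P" and le: "delta_Pi \<pi> \<pi>' \<le> ereal r"
  shows "dist_to delta_Pi \<pi> (Pi_topology frontier_of P) \<le> ereal r"
proof -
  define g :: "real \<Rightarrow> ('t, 'n) lsio" where
    "g s = (fst \<pi> + s *\<^sub>R (fst \<pi>' - fst \<pi>), \<lambda>t. snd \<pi> t + s *\<^sub>R (snd \<pi>' t - snd \<pi> t))" for s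
  have fst_le: "norm (fst \<pi>' - fst \<pi>) \<le> r"
    using le by (simp add: delta_Pi_def norm_minus_commute)
  have "ereal (norm (snd \<pi> t - snd \<pi>' t)) \<le> ereal r" for t
    using le by (intro order_trans[OF norm_le_delta_Sigma]) (simp add: delta_Pi_def)
  then have snd_le: "norm (snd \<pi>' t - snd \<pi> t) \<le> r" for t by (simp add: norm_minus_commute)
  have "0 \<le> r" using fst_le norm_ge_zero order_trans by blast
  have g_dist: "delta_Pi (g s) (g s') \<le> ereal (\<bar>s - s'\<bar> * r)" for s s'
  proof -
    have "norm (fst (g s) - fst (g s')) \<le> \<bar>s - s'\<bar> * r"
    proof -
      have "fst (g s) - fst (g s') = (s - s') *\<^sub>R (fst \<pi>' - fst \<pi>)"
        by (simp add: g_def algebra_simps)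
      then show ?thesis using fst_le by (simp add: mult_left_mono)
    qed
    moreover have "norm (snd (g s) t - snd (g s') t) \<le> \<bar>s - s'\<bar> * r" for t
    proof -
      have "snd (g s) t - snd (g s') t = (s - s') *\<^sub>R (snd \<pi>' t - snd \<pi> t)"
        by (simp add: g_def algebra_simps)
      then show ?thesis using snd_le[of t] by (simp add: mult_left_mono)
    qed
    ultimately show ?thesis unfolding delta_Pi_def by (simp add: delta_Sigma_leI)
  qed
  have "continuous_map euclideanreal Pi_topology g"
    unfolding continuous_map
  proof (intro conjI allI impI)
    show "g ` topspace euclideanreal \<subseteq> topspace Pi_topology" by (simp add: topspace_edist_topology)
    fix W :: "('t, 'n) lsio set"
    assume W: "openin Pi_topology W"
    have "\<exists>e>0. ball s e \<subseteq> {x. g x \<in> W}" if s: "g s \<in> W" for s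
    proof -
      obtain e where e: "e > 0" "\<And>\<pi>''. delta_Pi (g s) \<pi>'' < e \<Longrightarrow> \<pi>'' \<in> W"
        using W s unfolding openin_edist_topology by blast
      obtain e' where e': "0 < e'" "ereal e' \<le> e"
        using e(1) by (cases e) (auto intro: that[of 1])
      have "g s' \<in> W" if "s' \<in> ball s (e' / (r + 1))" for s'
      proof (rule e(2))
        have "\<bar>s - s'\<bar> < e' / (r + 1)" using that by (simp add: dist_real_def)
        then have "\<bar>s - s'\<bar> * (r + 1) < e'" using \<open>0 \<le> r\<close> by (simp add: field_simps)
        then have "\<bar>s - s'\<bar> * r < e'" by (simp add: distrib_left)
        then have "ereal (\<bar>s - s'\<bar> * r) < ereal e'" by simp
        then show "delta_Pi (g s) (g s') < e"
          using g_dist[of s s'] e'(2) by order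
      qed
      then show ?thesis using \<open>0 \<le> r\<close> e'(1) by (intro exI[of _ "e' / (r + 1)"]) auto
    qed
    then show "openin euclideanreal {x \<in> topspace euclideanreal. g x \<in> W}"
      by (simp add: open_contains_ball)
  qed
  then have "connectedin Pi_topology (g ` {0..1})"
    by (rule connectedin_continuous_map_image) simp
  moreover have "g 0 = \<pi>" "g 1 = \<pi>'" by (simp_all add: g_def)
  then have "\<pi> \<in> g ` {0..1} \<inter> P" "\<pi>' \<in> g ` {0..1} - P"
    using assms(1,2) by (force simp: image_iff)+
  ultimately have "g ` {0..1} \<inter> Pi_topology frontier_of P \<noteq> {}"
    by (intro connectedin_Int_frontier_of) blast+
  then obtain s where s: "0 \<le> s" "s \<le> 1" "g s \<in> Pi_topology frontier_of P" by auto
  have "dist_to delta_Pi \<pi> (Pi_topology frontier_of P) \<le> delta_Pi \<pi> (g s)"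
    unfolding dist_to_def using s(3) by (rule INF_lower)
  also have "\<dots> \<le> ereal (s * r)" using g_dist[of 0 s] s(1) \<open>g 0 = \<pi>\<close> by simp
  also have "\<dots> \<le> ereal r" using s \<open>0 \<le> r\<close> by (simp add: mult_left_le_one_le)
  finally show ?thesis .
qed

section \<open>Solvable problems\<close>

text \<open>Under a perturbation of size below \<open>r\<close>, the Slater point stays feasible as long as
  \<open>r * (1 + norm x0) \<le> \<rho>\<close>. A point \<open>x\<close> that is feasible for the perturbed problem and no
  costlier than \<open>x0\<close> satisfies the inequalities of the original generators up to \<open>r * norm x\<close> plus a constant.
  For \<open>r < d\<close> this term is absorbed by the bound coming from the ball, so sublevel sets are bounded.\<close>

lemma interior_Pi_s_if_Slater:
  fixes \<pi> :: "('t, 'n::finite) lsio"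
  assumes ball: "cball 0 d \<subseteq> Z_minus \<pi>" and "0 < d"
    and slater: "\<And>t. snd (snd \<pi> t) + \<rho> \<le> fst (snd \<pi> t) \<bullet> x0" and "0 < \<rho>"
    and below: "\<And>t. - B \<le> snd (snd \<pi> t)"
  shows "\<pi> \<in> Pi_topology interior_of Pi_s"
proof -
  define r where "r = min (d / 2) (\<rho> / (1 + norm x0))"
  have pos: "0 < 1 + norm x0" by (simp add: add_pos_nonneg)
  have r: "0 < r" "r < d" and "r \<le> \<rho> / (1 + norm x0)"
    using \<open>0 < d\<close> \<open>0 < \<rho>\<close> pos by (auto simp: r_def)
  then have r\<rho>: "r + r * norm x0 \<le> \<rho>" using pos by (simp add: field_simps)
  show ?thesis
  proof (rule in_Pi_interiorI[OF \<open>0 < r\<close>])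
    fix \<pi>' :: "('t, 'n) lsio"
    assume less: "delta_Pi \<pi> \<pi>' < ereal r"
    have c: "norm (fst \<pi> - fst \<pi>') \<le> r" using less by (simp add: delta_Pi_def)
    have "ereal (norm (snd \<pi> t - snd \<pi>' t)) < ereal r" for t
      using less by (intro order_le_less_trans[OF norm_le_delta_Sigma]) (simp add: delta_Pi_def)
    then have "norm (snd \<pi> t - snd \<pi>' t) \<le> r" for t by (simp add: less_imp_le)
    moreover have "norm (fst w) \<le> norm w" "\<bar>snd w\<bar> \<le> norm w" for w :: "(real ^ 'n) \<times> real"
      using norm_fst_le[of "fst w" "snd w"] norm_snd_le[of "snd w" "fst w"] by simp_all
    ultimately have a: "norm (fst (snd \<pi> t) - fst (snd \<pi>' t)) \<le> r"
      and b: "\<bar>snd (snd \<pi> t) - snd (snd \<pi>' t)\<bar> \<le> r" for t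
      by (metis fst_diff order_trans, metis snd_diff order_trans)
    have inner_le: "\<bar>p \<bullet> x - q \<bullet> x\<bar> \<le> r * norm x" if "norm (p - q) \<le> r" for p q x :: "real ^ 'n"
      using Cauchy_Schwarz_ineq2[of "p - q" x] mult_right_mono[OF that norm_ge_zero[of x]]
      by (simp add: inner_diff_left)
    have "x0 \<in> feasible (snd \<pi>')"
      unfolding feasible_def
    proof safe
      fix t
      show "snd (snd \<pi>' t) \<le> fst (snd \<pi>' t) \<bullet> x0"
        using slater[of t] inner_le[OF a[of t], of x0] b[of t] r\<rho> by linarith
    qed
    moreover have "norm x \<le> (\<bar>B\<bar> + r + \<bar>fst \<pi>' \<bullet> x0\<bar>) / (d - r)"
      if x: "x \<in> feasible (snd \<pi>')" "fst \<pi>' \<bullet> x \<le> fst \<pi>' \<bullet> x0" for x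
    proof -
      have "d * norm x \<le> (\<bar>B\<bar> + r + \<bar>fst \<pi>' \<bullet> x0\<bar>) + r * norm x"
      proof (rule norm_bound_from_inner_ball[OF ball[unfolded Z_minus_def]])
        show "0 \<le> d" using \<open>0 < d\<close> by simp
        fix g assume "g \<in> range (\<lambda>t. fst (snd \<pi> t)) \<union> {- fst \<pi>}"
        then consider t where "g = fst (snd \<pi> t)" | "g = - fst \<pi>" by blast
        then show "- (\<bar>B\<bar> + r + \<bar>fst \<pi>' \<bullet> x0\<bar> + r * norm x) \<le> g \<bullet> x"
        proof cases
          case 1
          have "snd (snd \<pi>' t) \<le> fst (snd \<pi>' t) \<bullet> x" using x(1) by (simp add: feasible_def)
          then show ?thesis
            using inner_le[OF a[of t], of x] b[of t] below[of t] unfolding 1 by linarith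
        next
          case 2
          then show ?thesis using inner_le[OF c, of x] x(2) r(1) by simp
        qed
      qed
      then show ?thesis using r by (simp add: field_simps)
    qed
    ultimately show "\<pi>' \<in> Pi_s"
      unfolding Pi_s_def using opt_set_nonempty_if_sublevel_bounded by blast
  qed
qed

text \<open>Moving an optimal point along \<open>y\<close> would keep it feasible and lower its cost.\<close>

lemma not_in_Pi_s_if_descent_direction:
  assumes dir: "\<And>t. 0 \<le> fst (snd \<pi> t) \<bullet> y" and descent: "fst \<pi> \<bullet> y < 0"
  shows "\<pi> \<notin> Pi_s"
proof
  assume "\<pi> \<in> Pi_s"
  then obtain x where x: "x \<in> feasible (snd \<pi>)" "ereal (fst \<pi> \<bullet> x) = opt_value \<pi>"
    by (auto simp: Pi_s_def opt_set_def)
  have "x + y \<in> feasible (snd \<pi>)"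
    using x(1) dir by (simp add: feasible_def inner_add_right add_increasing2)
  then have "opt_value \<pi> \<le> ereal (fst \<pi> \<bullet> (x + y))"
    unfolding opt_value_def by (rule INF_lower)
  with x(2)[symmetric] descent show False by (simp add: inner_add_right)
qed

lemma dist_to_bd_Pi_s_le_dist_Sigma_i:
  fixes \<pi> :: "('t, 'n::finite) lsio"
  assumes "\<pi> \<in> Pi_s"
  shows "dist_to delta_Pi \<pi> (Pi_topology frontier_of Pi_s) \<le> dist_to delta_Sigma (snd \<pi>) Sigma_i"
  unfolding dist_to_def[of delta_Sigma]
proof (rule INF_greatest)
  fix \<sigma>' :: "('t, 'n) system" assume "\<sigma>' \<in> Sigma_i"
  then have "(fst \<pi>, \<sigma>') \<notin> Pi_s" by (simp add: Pi_s_def opt_set_def Sigma_i_def)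
  moreover have "delta_Pi \<pi> (fst \<pi>, \<sigma>') = delta_Sigma (snd \<pi>) \<sigma>'"
    by (simp add: delta_Pi_def delta_Sigma_nonneg max_absorb2 zero_ereal_def[symmetric])
  ultimately show "dist_to delta_Pi \<pi> (Pi_topology frontier_of Pi_s) \<le> delta_Sigma (snd \<pi>) \<sigma>'"
    using dist_to_frontier_le[OF assms, of "(fst \<pi>, \<sigma>')"] delta_Sigma_nonneg[of "snd \<pi>" \<sigma>']
    by (cases "delta_Sigma (snd \<pi>) \<sigma>'") auto
qed

text \<open>Translating all constraint vectors and \<open>- fst \<pi>\<close> by \<open>- z\<close>, for a boundary point \<open>z\<close> of
  \<open>Z_minus \<pi>\<close>, moves the origin to the boundary of the hull. A further translation by \<open>e\<close> along the normal
  of a supporting hyperplane makes all generators strictly positive on that normal, which is then a direction of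
  unbounded descent.\<close>

lemma dist_to_bd_Pi_s_le_dist_bd_Z_minus:
  fixes \<pi> :: "('t, 'n::finite) lsio"
  assumes "\<pi> \<in> Pi_s"
  shows "dist_to delta_Pi \<pi> (Pi_topology frontier_of Pi_s) \<le> dist_to edist 0 (frontier (Z_minus \<pi>))"
  unfolding dist_to_def[of edist]
proof (rule INF_greatest)
  fix z assume "z \<in> frontier (Z_minus \<pi>)"
  then have "z \<notin> interior (Z_minus \<pi>)" by (simp add: frontier_def)
  then obtain y0 where y0: "y0 \<noteq> 0" "\<And>x. x \<in> Z_minus \<pi> \<Longrightarrow> y0 \<bullet> z \<le> y0 \<bullet> x"
    using supporting_functional_at_non_interior_point[of "Z_minus \<pi>" z] by (auto simp: Z_minus_def)
  define y where "y = sgn y0"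
  have y: "norm y = 1" "\<And>x. x \<in> Z_minus \<pi> \<Longrightarrow> 0 \<le> (x - z) \<bullet> y"
    using y0 by (simp_all add: y_def norm_sgn sgn_div_norm inner_commute[of _ y0] inner_diff_right)
  have yy: "y \<bullet> y = 1" using y(1) by (simp add: norm_eq_1)
  have "dist_to delta_Pi \<pi> (Pi_topology frontier_of Pi_s) \<le> edist 0 z + ereal e" if "0 < e" for e
  proof -
    \<comment> \<open>Constraint vectors move by \<open>- w\<close> and \<open>fst \<pi>\<close> by \<open>w\<close>, so that all generators of the hull,
      \<open>- fst \<pi>\<close> included, undergo the same translation.\<close>
    define w where "w = z - e *\<^sub>R y"
    define \<pi>' :: "('t, 'n) lsio" where
      "\<pi>' = (fst \<pi> + w, \<lambda>t. (fst (snd \<pi> t) - w, snd (snd \<pi> t)))"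
    have "norm w \<le> norm z + e"
      using norm_triangle_ineq4[of z "e *\<^sub>R y"] y(1) that by (simp add: w_def)
    then have "delta_Pi \<pi> \<pi>' \<le> ereal (norm z + e)"
      unfolding delta_Pi_def by (auto simp: \<pi>'_def minus_prod_def norm_Pair intro!: delta_Sigma_leI)
    moreover have "\<pi>' \<notin> Pi_s"
    proof (rule not_in_Pi_s_if_descent_direction[where y = y])
      fix t
      have "fst (snd \<pi> t) \<in> Z_minus \<pi>" unfolding Z_minus_def by (rule hull_inc) simp
      then have "0 \<le> (fst (snd \<pi> t) - z) \<bullet> y" by (rule y(2))
      then show "0 \<le> fst (snd \<pi>' t) \<bullet> y"
        using that by (simp add: \<pi>'_def w_def inner_diff_left yy)
    next
      have "- fst \<pi> \<in> Z_minus \<pi>" unfolding Z_minus_def by (rule hull_inc) simp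
      then have "0 \<le> (- fst \<pi> - z) \<bullet> y" by (rule y(2))
      then show "fst \<pi>' \<bullet> y < 0"
        using that by (simp add: \<pi>'_def w_def inner_diff_left inner_add_left yy)
    qed
    ultimately show ?thesis
      using dist_to_frontier_le[OF assms] by (simp add: edist_def)
  qed
  then show "dist_to delta_Pi \<pi> (Pi_topology frontier_of Pi_s) \<le> edist 0 z"
    by (rule ereal_le_epsilon2)
qed

section \<open>Repairing constraint violations\<close>

text \<open>The conclusion asks for \<open>z = y - x\<close> with \<open>b - v \<bullet> x \<le> (v + w) \<bullet> z\<close> for all \<open>v\<close> in \<open>K\<close> and
  all \<open>w\<close> of norm at most \<open>\<kappa>\<close>, the worst \<open>w\<close> being \<open>- \<kappa> *\<^sub>R sgn z\<close>. The pairs \<open>(v + w, b - v \<bullet> x)\<close> form a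
  compact convex set, and the hypothesis says exactly that it misses the ray \<open>{0} \<times> {0..}\<close>, because \<open>v + w = 0\<close>
  forces \<open>norm v \<le> \<kappa>\<close>. A hyperplane separating the two yields \<open>z\<close>.\<close>

lemma slack_proportional_to_distance:
  fixes K :: "'a::euclidean_space set"
  assumes K: "compact K" "convex K" "K \<noteq> {}" and "0 \<le> \<kappa>"
    and short: "\<And>v. v \<in> K \<Longrightarrow> norm v \<le> \<kappa> \<Longrightarrow> b < v \<bullet> x"
  obtains y where "\<And>v. v \<in> K \<Longrightarrow> b + \<kappa> * norm (y - x) \<le> v \<bullet> y"
proof -
  define M where "M = (\<lambda>(v, w). (v + w, b - v \<bullet> x)) ` (K \<times> cball 0 \<kappa>)"
  have "compact M"
    unfolding M_def case_prod_unfold using K(1)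
    by (intro compact_continuous_image continuous_intros compact_Times compact_cball)
  have "convex M"
  proof -
    have "linear (\<lambda>p :: 'a \<times> 'a. (fst p + snd p, - (fst p \<bullet> x)))"
      by (rule linearI) (auto simp: inner_add_left scaleR_add_right)
    then have "convex ((\<lambda>p. (fst p + snd p, - (fst p \<bullet> x))) ` (K \<times> cball 0 \<kappa>))"
      using K(2) by (intro convex_linear_image convex_Times convex_cball)
    then have "convex ((+) (0, b) ` (\<lambda>p. (fst p + snd p, - (fst p \<bullet> x))) ` (K \<times> cball 0 \<kappa>))"
      by (rule convex_translation)
    then show ?thesis by (simp add: M_def image_image case_prod_unfold)
  qed
  have "M \<noteq> {}" using K(3) \<open>0 \<le> \<kappa>\<close> by (auto simp: M_def)
  have "({0} \<times> {0..}) \<inter> M = {}"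
  proof -
    have "b - v \<bullet> x < 0" if "v \<in> K" "norm w \<le> \<kappa>" "v + w = 0" for v w
    proof -
      have "w = - v" using that(3) by (simp add: eq_neg_iff_add_eq_0 add.commute)
      then show ?thesis using short[of v] that by simp
    qed
    then show ?thesis by (fastforce simp: M_def)
  qed
  moreover have "convex ({0::'a} \<times> {0::real..})" "closed ({0::'a} \<times> {0::real..})"
    by (auto intro!: convex_Times closed_Times)
  ultimately obtain a \<beta> where sep:
      "\<And>p. p \<in> {0} \<times> {0..} \<Longrightarrow> a \<bullet> p < \<beta>" "\<And>p. p \<in> M \<Longrightarrow> \<beta> < a \<bullet> p"
    using separating_hyperplane_closed_compact[of "{0} \<times> {0..}" M]
      \<open>compact M\<close> \<open>convex M\<close> \<open>M \<noteq> {}\<close> by metis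
  obtain z \<tau> where a: "a = (z, \<tau>)" by (cases a)
  have ray: "\<tau> * s < \<beta>" if "0 \<le> s" for s using sep(1)[of "(0, s)"] that by (simp add: a)
  then have "0 < \<beta>" by (metis mult_zero_right order_refl)
  have "\<tau> \<le> 0" using ray[of "\<beta> / \<tau>"] \<open>0 < \<beta>\<close> by (cases "\<tau> \<le> 0") auto
  \<comment> \<open>A hyperplane with \<open>\<tau> < 0\<close> is rescaled to \<open>\<tau> = - 1\<close>. A vertical one bounds \<open>p \<bullet> z\<close> below by \<open>\<beta> > 0\<close>
    on all of \<open>M\<close>, so a large multiple of \<open>z\<close> dominates the bounded second coordinate.\<close>
  obtain z' where z': "\<And>p q. (p, q) \<in> M \<Longrightarrow> q \<le> p \<bullet> z'"
  proof (cases "\<tau> = 0")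
    case False
    with \<open>\<tau> \<le> 0\<close> have "\<tau> < 0" by simp
    show ?thesis
    proof (rule that)
      fix p q assume "(p, q) \<in> M"
      then have "0 < p \<bullet> z + \<tau> * q" using sep(2)[of "(p, q)"] \<open>0 < \<beta>\<close> by (simp add: a inner_commute mult.commute)
      then show "q \<le> p \<bullet> ((1 / - \<tau>) *\<^sub>R z)" using \<open>\<tau> < 0\<close> by (simp add: field_simps)
    qed
  next
    case True
    obtain Q where Q: "0 < Q" "\<And>m. m \<in> M \<Longrightarrow> norm m \<le> Q"
      using compact_imp_bounded[OF \<open>compact M\<close>] bounded_pos by metis
    show ?thesis
    proof (rule that)
      fix p q assume pq: "(p, q) \<in> M"
      have "q \<le> Q" using norm_snd_le[of q p] Q(2)[OF pq] by simp
      also have "\<beta> < p \<bullet> z" using sep(2)[OF pq] True by (simp add: a inner_commute)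
      then have "Q \<le> p \<bullet> ((Q / \<beta>) *\<^sub>R z)" using \<open>0 < \<beta>\<close> Q(1) by (simp add: field_simps)
      finally show "q \<le> p \<bullet> ((Q / \<beta>) *\<^sub>R z)" .
    qed
  qed
  show ?thesis
  proof (rule that)
    fix v assume "v \<in> K"
    define w where "w = - (\<kappa> *\<^sub>R sgn z')"
    have "norm w \<le> \<kappa>" using \<open>0 \<le> \<kappa>\<close> by (simp add: w_def norm_sgn)
    then have "(v + w, b - v \<bullet> x) \<in> M" using \<open>v \<in> K\<close> by (force simp: M_def)
    then have "b - v \<bullet> x \<le> (v + w) \<bullet> z'" by (rule z')
    moreover have "w \<bullet> z' = - (\<kappa> * norm z')"
      by (cases "z' = 0") (simp_all add: w_def sgn_div_norm power2_norm_eq_inner[symmetric] power2_eq_square field_simps)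
    ultimately show "b + \<kappa> * norm ((x + z') - x) \<le> v \<bullet> (x + z')"
      by (simp add: inner_add_left inner_add_right)
  qed
qed

text \<open>Replacing the one constraint with index \<open>u\<close> by the contradictory \<open>0 \<bullet> x \<ge> s\<close> makes the system
  infeasible.\<close>

lemma dist_Sigma_i_le_one_constraint:
  fixes U :: "(real ^ 'n::finite) set"
  assumes "u \<in> U" "0 < s"
  shows "dist_to delta_Sigma (system_of b \<rho> U) Sigma_i \<le> ereal (norm (u, b - s))"
proof -
  define \<sigma>' where "\<sigma>' = (system_of b \<rho> U)(u := (0, s))"
  have "\<sigma>' \<in> Sigma_i" using assms(2) by (auto simp: Sigma_i_def feasible_def \<sigma>'_def intro!: exI[of _ u])
  then have "dist_to delta_Sigma (system_of b \<rho> U) Sigma_i \<le> delta_Sigma (system_of b \<rho> U) \<sigma>'"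
    unfolding dist_to_def by (rule INF_lower)
  also have "\<dots> \<le> ereal (norm (u, b - s))"
    using assms(1) by (intro delta_Sigma_leI) (auto simp: \<sigma>'_def system_of_def)
  finally show ?thesis .
qed

text \<open>The slack rate \<open>\<kappa>\<close> is chosen so that \<open>\<kappa> * sqrt (1 + (norm x)\<^sup>2) = D - \<epsilon>\<close>. If \<open>v\<close> had norm at most
  \<open>\<kappa>\<close> and \<open>v \<bullet> x \<le> b\<close>, then for \<open>u\<close> in \<open>U\<close> near \<open>v\<close> the constraint \<open>(u, b)\<close> could be turned into
  \<open>(0, b - v \<bullet> x + \<eta>)\<close>; this costs at most \<open>norm (u - v) + norm (v, v \<bullet> x) + \<eta> \<le> h + (D - \<epsilon>) + \<eta>\<close>, less than \<open>D\<close> for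
  small \<open>\<eta>\<close>, contrary to the choice of \<open>D\<close>. So there is a point \<open>y\<close> whose slack is \<open>\<kappa> * norm (y - x)\<close>, and the
  point \<open>x'\<close> lies on the segment from \<open>x\<close> to \<open>y\<close>. The same lemma serves for \<open>K = V\<close> and for \<open>K = U\<close>.\<close>

lemma feasible_point_near:
  fixes K U :: "(real ^ 'n::finite) set"
  assumes D: "ereal D \<le> dist_to delta_Sigma (system_of b \<rho> U) Sigma_i"
    and h: "0 \<le> h" "h < \<epsilon>" "\<epsilon> < D"
    and K: "compact K" "convex K" "K \<noteq> {}"
    and near: "\<And>v. v \<in> K \<Longrightarrow> \<exists>u\<in>U. norm (u - v) \<le> h"
    and x: "\<And>v. v \<in> K \<Longrightarrow> b - h * norm x \<le> v \<bullet> x"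
  obtains x' where "x' \<in> RO_feasible b K"
    and "norm (x' - x) \<le> h * (norm x * sqrt (1 + (norm x)\<^sup>2) / (D - \<epsilon>))"
proof -
  define q where "q = sqrt (1 + (norm x)\<^sup>2)"
  have "1 \<le> q" by (simp add: q_def)
  define \<kappa> where "\<kappa> = (D - \<epsilon>) / q"
  have \<kappa>: "0 < \<kappa>" "\<kappa> * q = D - \<epsilon>" using h \<open>1 \<le> q\<close> by (simp_all add: \<kappa>_def)
  have short: "b < v \<bullet> x" if v: "v \<in> K" "norm v \<le> \<kappa>" for v
  proof (rule ccontr)
    assume "\<not> b < v \<bullet> x"
    obtain u where u: "u \<in> U" "norm (u - v) \<le> h" using near[OF v(1)] by blast
    define \<eta> where "\<eta> = (\<epsilon> - h) / 2"
    have "0 < \<eta>" using h by (simp add: \<eta>_def)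
    have "norm (v, v \<bullet> x) \<le> norm v * q"
    proof -
      have "\<bar>v \<bullet> x\<bar>\<^sup>2 \<le> (norm v * norm x)\<^sup>2" by (intro power_mono Cauchy_Schwarz_ineq2) simp
      then have "norm (v, v \<bullet> x) \<le> sqrt ((norm v)\<^sup>2 * (1 + (norm x)\<^sup>2))"
        by (simp add: norm_Pair power_mult_distrib algebra_simps)
      then show ?thesis by (simp add: q_def real_sqrt_mult)
    qed
    also have "\<dots> \<le> \<kappa> * q" using v(2) \<open>1 \<le> q\<close> by (intro mult_right_mono) auto
    finally have "norm (v, v \<bullet> x) \<le> D - \<epsilon>" using \<kappa>(2) by simp
    moreover have "(u, v \<bullet> x - \<eta>) = (u - v, 0) + ((v, v \<bullet> x) + (0, - \<eta>))" by simp
    then have "norm (u, v \<bullet> x - \<eta>) \<le> norm (u - v) + (norm (v, v \<bullet> x) + \<eta>)"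
      using norm_triangle_ineq[of "(u - v, 0::real)" "(v, v \<bullet> x) + (0, - \<eta>)"]
        norm_triangle_ineq[of "(v, v \<bullet> x)" "(0, - \<eta>)"] \<open>0 < \<eta>\<close>
      by (simp add: norm_Pair)
    ultimately have "norm (u, v \<bullet> x - \<eta>) \<le> h + (D - \<epsilon>) + \<eta>" using u(2) by linarith
    then have "norm (u, v \<bullet> x - \<eta>) < D" using h by (simp add: \<eta>_def field_simps)
    moreover have "ereal D \<le> ereal (norm (u, b - (b - v \<bullet> x + \<eta>)))"
      using order_trans[OF D dist_Sigma_i_le_one_constraint[OF u(1), of "b - v \<bullet> x + \<eta>"]]
        \<open>\<not> b < v \<bullet> x\<close> \<open>0 < \<eta>\<close> by simp
    ultimately show False by simp
  qed
  obtain y where y: "\<And>v. v \<in> K \<Longrightarrow> b + \<kappa> * norm (y - x) \<le> v \<bullet> y"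
    using slack_proportional_to_distance[OF K less_imp_le[OF \<kappa>(1)] short] by blast
  define e where "e = h * norm x"
  define r where "r = norm (y - x)"
  have "0 \<le> e" "0 \<le> r" using h by (simp_all add: e_def r_def)
  show ?thesis
  proof (cases "e = 0")
    case True
    then show ?thesis using x by (intro that[of x]) (auto simp: RO_feasible_def e_def)
  next
    case False
    with \<open>0 \<le> e\<close> have "0 < e" by simp
    have pos: "0 < e + \<kappa> * r" using \<open>0 < e\<close> \<open>0 \<le> r\<close> \<kappa>(1) by (simp add: add_pos_nonneg)
    \<comment> \<open>At this fraction of the way to \<open>y\<close>, the violation \<open>(1 - \<theta>) * e\<close> that remains from \<open>x\<close> is exactly
      offset by the slack \<open>\<theta> * \<kappa> * r\<close> gained from \<open>y\<close>.\<close>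
    define \<theta> where "\<theta> = e / (e + \<kappa> * r)"
    have \<theta>: "0 \<le> \<theta>" "\<theta> \<le> 1" "\<theta> * (e + \<kappa> * r) = e"
      using \<open>0 < e\<close> \<open>0 \<le> r\<close> \<kappa>(1) pos by (simp_all add: \<theta>_def)
    show ?thesis
    proof (rule that[of "x + \<theta> *\<^sub>R (y - x)"])
      have "b \<le> v \<bullet> (x + \<theta> *\<^sub>R (y - x))" if "v \<in> K" for v
      proof -
        have "b = (1 - \<theta>) * (b - e) + \<theta> * (b + \<kappa> * r)" using \<theta>(3) by (simp add: algebra_simps)
        also have "\<dots> \<le> (1 - \<theta>) * (v \<bullet> x) + \<theta> * (v \<bullet> y)"
          using x[OF that] y[OF that] \<theta> by (intro add_mono mult_left_mono) (auto simp: e_def r_def)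
        finally show ?thesis by (simp add: inner_add_right inner_diff_right algebra_simps)
      qed
      then show "x + \<theta> *\<^sub>R (y - x) \<in> RO_feasible b K" by (simp add: RO_feasible_def)
      have "\<theta> * r \<le> e / \<kappa>"
        using \<kappa>(1) \<theta>(3) mult_nonneg_nonneg[OF \<theta>(1) \<open>0 \<le> e\<close>] by (simp add: field_simps)
      also have "\<dots> = h * (norm x * q / (D - \<epsilon>))" by (simp add: e_def \<kappa>_def)
      finally show "norm (x + \<theta> *\<^sub>R (y - x) - x) \<le> h * (norm x * sqrt (1 + (norm x)\<^sup>2) / (D - \<epsilon>))"
        using \<theta>(1) by (simp add: r_def q_def)
    qed
  qed
qed

lemma RO_value_le_near_feasible:
  fixes K U :: "(real ^ 'n::finite) set"
  assumes D: "ereal D \<le> dist_to delta_Sigma (system_of b \<rho> U) Sigma_i"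
    and h: "0 \<le> h" "h < \<epsilon>" "\<epsilon> < D"
    and K: "compact K" "convex K" "K \<noteq> {}"
    and near: "\<And>v. v \<in> K \<Longrightarrow> \<exists>u\<in>U. norm (u - v) \<le> h"
    and x: "\<And>v. v \<in> K \<Longrightarrow> b - h * norm x \<le> v \<bullet> x"
    and "norm x \<le> m"
  shows "RO_value c b K \<le> ereal (c \<bullet> x + norm c * ((1 + m) * sqrt (1 + m\<^sup>2) / (D - \<epsilon>)) * h)"
proof -
  obtain x' where x': "x' \<in> RO_feasible b K"
      "norm (x' - x) \<le> h * (norm x * sqrt (1 + (norm x)\<^sup>2) / (D - \<epsilon>))"
    using feasible_point_near[OF D h K near x] by blast
  have "norm x * sqrt (1 + (norm x)\<^sup>2) \<le> (1 + m) * sqrt (1 + m\<^sup>2)"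
    using \<open>norm x \<le> m\<close> order_trans[OF norm_ge_zero \<open>norm x \<le> m\<close>] by (intro mult_mono) auto
  then have "norm (x' - x) \<le> h * ((1 + m) * sqrt (1 + m\<^sup>2) / (D - \<epsilon>))"
    using x'(2) h by (elim order_trans) (intro mult_left_mono divide_right_mono; simp)
  then have "norm c * norm (x' - x) \<le> norm c * (h * ((1 + m) * sqrt (1 + m\<^sup>2) / (D - \<epsilon>)))"
    by (rule mult_left_mono) simp
  moreover have "c \<bullet> x' = c \<bullet> x + c \<bullet> (x' - x)" by (simp add: inner_diff_right)
  moreover have "c \<bullet> (x' - x) \<le> norm c * norm (x' - x)" by (rule norm_cauchy_schwarz)
  ultimately have "c \<bullet> x' \<le> c \<bullet> x + norm c * ((1 + m) * sqrt (1 + m\<^sup>2) / (D - \<epsilon>)) * h"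
    by (simp add: mult_ac)
  moreover have "RO_value c b K \<le> ereal (c \<bullet> x')"
    unfolding RO_value_def using x'(1) by (rule INF_lower)
  ultimately show ?thesis by (simp add: order_trans)
qed

section \<open>The constant\<close>

text \<open>A ball around the origin that misses the boundary of a set containing the origin is contained in
  the set, since balls are connected.\<close>

lemma edist_0_frontier_inner_ball:
  fixes S :: "'a::euclidean_space set"
  assumes "compact S" "0 \<in> S"
  obtains d where "dist_to edist 0 (frontier S) = ereal d" "0 \<le> d" "cball 0 d \<subseteq> S"
proof -
  have "S \<noteq> UNIV" using \<open>compact S\<close> not_compact_UNIV by blast
  then have "frontier S \<noteq> {}" using \<open>0 \<in> S\<close> frontier_not_empty by blast
  moreover have "compact (frontier S)" using \<open>compact S\<close> by (rule compact_frontier)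
  ultimately obtain z where z: "z \<in> frontier S" "\<And>w. w \<in> frontier S \<Longrightarrow> norm z \<le> norm w"
    using continuous_attains_inf[OF _ _ continuous_on_norm_id, of "frontier S"] by blast
  have "dist_to edist 0 (frontier S) = ereal (norm z)"
    unfolding dist_to_def edist_def using z
    by (intro antisym INF_greatest INF_lower2[of z]) auto
  moreover have "ball 0 (norm z) \<subseteq> S"
  proof (rule ccontr)
    assume "\<not> ball 0 (norm z) \<subseteq> S"
    then obtain x where x: "x \<in> ball 0 (norm z)" "x \<notin> S" by blast
    then have "0 < norm z" using norm_ge_zero[of x] by (simp del: zero_less_norm_iff norm_ge_zero)
    then have "ball 0 (norm z) \<inter> S \<noteq> {}" using \<open>0 \<in> S\<close> by (force simp: disjoint_iff)
    moreover have "ball 0 (norm z) - S \<noteq> {}" using x by blast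
    ultimately have "ball 0 (norm z) \<inter> frontier S \<noteq> {}"
      by (intro connected_Int_frontier) auto
    with z(2) show False by fastforce
  qed
  then have "cball 0 (norm z) \<subseteq> S"
    using closure_minimal[of "ball 0 (norm z)" S] compact_imp_closed[OF \<open>compact S\<close>] \<open>0 \<in> S\<close>
    by (cases "z = 0") auto
  ultimately show ?thesis using that norm_ge_zero by blast
qed

lemma phi_0: "phi 0 = 1"
proof -
  have "1 + (0::ereal)\<^sup>2 = ereal 1" by (simp add: one_ereal_def power2_eq_square)
  then show ?thesis by (simp add: phi_def sqrt_ereal_def one_ereal_def)
qed

lemma psi_ereal: "psi (ereal r) = ereal ((1 + r) * sqrt (1 + r\<^sup>2))"
proof -
  have "1 + (ereal r)\<^sup>2 = ereal (1 + r\<^sup>2)" by (simp add: one_ereal_def power2_eq_square)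
  then show ?thesis by (simp add: psi_def sqrt_ereal_def one_ereal_def)
qed

text \<open>Once the three data are finite, the constant can be computed in the reals. The quantities \<open>g\<close> and
  \<open>m\<close> are the values of \<open>max 1 (gamma_const \<pi> \<epsilon>)\<close> and \<open>mu_const \<pi> \<epsilon>\<close>.\<close>

lemma L_const_real:
  assumes "Sup (R_set \<pi>) = ereal s" "dist_to edist 0 (frontier (Z_minus \<pi>)) = ereal d"
    and "dist_to delta_Sigma (snd \<pi>) Sigma_i = ereal D"
    and "d \<noteq> 0" "d \<noteq> \<epsilon>" "D \<noteq> \<epsilon>"
  obtains g m where "1 \<le> g" "m = (s + \<epsilon> * g) / (d - \<epsilon>)"
    and "L_const \<pi> \<epsilon> = ereal ((\<epsilon> + norm (fst \<pi>)) * ((1 + m) * sqrt (1 + m\<^sup>2) / (D - \<epsilon>)) + m)"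
proof -
  define \<beta> where "\<beta> = (1 + s / d) * sqrt (1 + (s / d)\<^sup>2) / (D - \<epsilon>)"
  define g where "g = max 1 (s / d + \<epsilon> * \<beta> + norm (fst \<pi>) * \<beta>)"
  have rho: "rho_hat \<pi> = ereal (s / d)" using assms by (simp add: rho_hat_def)
  have "beta_const \<pi> \<epsilon> = ereal \<beta>" using assms by (simp add: beta_const_def rho psi_ereal \<beta>_def)
  then have "max 1 (gamma_const \<pi> \<epsilon>) = ereal g"
    by (simp add: gamma_const_def rho phi_0 g_def one_ereal_def)
  then have "mu_const \<pi> \<epsilon> = ereal ((s + \<epsilon> * g) / (d - \<epsilon>))"
    using assms by (simp add: mu_const_def phi_0)
  then have "L_const \<pi> \<epsilon> = ereal ((\<epsilon> + norm (fst \<pi>)) * ((1 + (s + \<epsilon> * g) / (d - \<epsilon>))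
      * sqrt (1 + ((s + \<epsilon> * g) / (d - \<epsilon>))\<^sup>2) / (D - \<epsilon>)) + (s + \<epsilon> * g) / (d - \<epsilon>))"
    using assms by (simp add: L_const_def phi_0 psi_ereal)
  moreover have "1 \<le> g" by (simp add: g_def)
  ultimately show ?thesis using that by blast
qed

section \<open>The problem attached to an uncertainty set\<close>

lemma feasible_system_of: "0 \<le> \<rho> \<Longrightarrow> feasible (system_of b \<rho> U) = RO_feasible b U"
  by (auto simp: feasible_def RO_feasible_def system_of_def split: if_splits)

text \<open>The artificial constraint really occurs, because a compact set is not the whole space.\<close>

lemma range_system_of:
  fixes U :: "(real ^ 'n::finite) set"
  assumes "compact U"
  shows "range (system_of b \<rho> U) = insert (0, - \<rho>) ((\<lambda>u. (u, b)) ` U)"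
proof -
  have "U \<noteq> UNIV" using assms not_compact_UNIV by blast
  then show ?thesis by (auto simp: system_of_def image_iff)
qed

lemma Z_minus_lsio_of:
  fixes U :: "(real ^ 'n::finite) set"
  assumes "compact U"
  shows "Z_minus (lsio_of c b \<rho> U) = convex hull (insert 0 (insert (- c) U))"
proof -
  have "range (\<lambda>t. fst (system_of b \<rho> U t)) = fst ` range (system_of b \<rho> U)" by (simp add: image_image)
  also have "\<dots> = insert 0 U" by (simp add: range_system_of[OF assms] image_image)
  finally show ?thesis by (simp add: Z_minus_def lsio_of_def insert_commute)
qed

lemma Sup_R_set_lsio_of:
  fixes U :: "(real ^ 'n::finite) set"
  assumes "compact U" "U \<noteq> {}" "0 \<le> \<rho>" "RO_value c b U = ereal p"
  shows "Sup (R_set (lsio_of c b \<rho> U)) = ereal (max (- b) (max \<rho> p))"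
proof -
  have "range (\<lambda>t. - ereal (snd (system_of b \<rho> U t))) = (\<lambda>q. - ereal (snd q)) ` range (system_of b \<rho> U)"
    by (simp add: image_image)
  also have "\<dots> = {ereal \<rho>, ereal (- b)}"
    using assms(2) by (auto simp: range_system_of[OF assms(1)] image_image)
  finally have "R_set (lsio_of c b \<rho> U) = {ereal (- b), ereal \<rho>, ereal p}"
    using assms(3,4) by (auto simp: R_set_def lsio_of_def opt_value_def feasible_system_of RO_value_def)
  then show ?thesis by (simp add: sup_max)
qed

text \<open>Otherwise some \<open>y \<noteq> 0\<close> is nonnegative on \<open>U\<close> and on \<open>- c\<close>, and the ray from an optimal point in the
  direction \<open>y\<close> consists of optimal points.\<close>

lemma zero_in_interior_Z_minus:
  fixes U :: "(real ^ 'n::finite) set"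
  assumes "compact U" and opt: "x \<in> RO_opt c b U" and bnd: "bounded (RO_opt c b U)"
  shows "0 \<in> interior (Z_minus (lsio_of c b \<rho> U))"
proof (rule ccontr)
  assume "0 \<notin> interior (Z_minus (lsio_of c b \<rho> U))"
  then obtain y where y: "y \<noteq> 0" "\<And>z. z \<in> Z_minus (lsio_of c b \<rho> U) \<Longrightarrow> y \<bullet> 0 \<le> y \<bullet> z"
    using supporting_functional_at_non_interior_point[of "Z_minus (lsio_of c b \<rho> U)" 0]
    by (auto simp: Z_minus_def)
  have gen: "0 \<le> z \<bullet> y" if "z \<in> insert (- c) U" for z
    using y(2)[of z] that hull_inc[of z "insert 0 (insert (- c) U)" convex]
    by (auto simp: Z_minus_lsio_of[OF assms(1)] inner_commute)
  have ray: "x + s *\<^sub>R y \<in> RO_opt c b U" if "0 \<le> s" for s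
  proof -
    have feas: "x + s *\<^sub>R y \<in> RO_feasible b U"
      using opt gen that by (auto simp: RO_opt_def RO_feasible_def inner_add_right intro!: add_increasing2)
    have "c \<bullet> (x + s *\<^sub>R y) \<le> c \<bullet> x"
      using gen[of "- c"] that by (simp add: inner_add_right mult_nonneg_nonpos)
    then have "ereal (c \<bullet> (x + s *\<^sub>R y)) \<le> RO_value c b U"
      using opt by (auto simp: RO_opt_def dest: sym)
    moreover have "RO_value c b U \<le> ereal (c \<bullet> (x + s *\<^sub>R y))"
      unfolding RO_value_def using feas by (rule INF_lower)
    ultimately show ?thesis using feas by (simp add: RO_opt_def)
  qed
  obtain B where B: "\<And>w. w \<in> RO_opt c b U \<Longrightarrow> norm w \<le> B" using bnd unfolding bounded_iff by blast
  define s where "s = (B + norm x + 1) / norm y"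
  have "0 \<le> B" using B[OF opt] norm_ge_zero[of x] by linarith
  then have "0 \<le> s" "s * norm y = B + norm x + 1" using y(1) by (simp_all add: s_def)
  then have "norm (s *\<^sub>R y) = B + norm x + 1" by simp
  moreover have "norm (s *\<^sub>R y) \<le> norm (x + s *\<^sub>R y) + norm x"
    using norm_triangle_ineq4[of "x + s *\<^sub>R y" x] by simp
  ultimately show False using B[OF ray[OF \<open>0 \<le> s\<close>]] by simp
qed

lemma attained_dist_to:
  assumes "compact V" "V \<noteq> {}" and le: "dist_to edist u V \<le> ereal h"
  obtains v where "v \<in> V" "dist u v \<le> h"
proof -
  obtain v where v: "v \<in> V" "\<And>w. w \<in> V \<Longrightarrow> dist u v \<le> dist u w"
    using continuous_attains_inf[OF assms(1,2) continuous_on_dist[OF continuous_on_const[of _ u] continuous_on_id]]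
    by blast
  then have "ereal (dist u v) \<le> dist_to edist u V"
    unfolding dist_to_def edist_def by (intro INF_greatest) simp
  then show ?thesis using le that[OF v(1)] order_trans by fastforce
qed

text \<open>An empty \<open>V\<close> is at infinite distance from a non-empty \<open>U\<close>. By compactness, nearest points exist
  within the Hausdorff distance itself, with no loss of an arbitrarily small amount.\<close>

lemma finite_hausdorff_distance:
  fixes U V :: "'a::euclidean_space set"
  assumes "compact U" "compact V" "U \<noteq> {}" and less: "hausdorff_distance U V < ereal \<epsilon>"
  obtains h where "hausdorff_distance U V = ereal h" "0 \<le> h" "h < \<epsilon>" "V \<noteq> {}"
    and "\<And>u. u \<in> U \<Longrightarrow> \<exists>v\<in>V. dist u v \<le> h" "\<And>v. v \<in> V \<Longrightarrow> \<exists>u\<in>U. dist v u \<le> h"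
proof -
  have 1: "dist_to edist u V \<le> hausdorff_distance U V" if "u \<in> U" for u
    unfolding hausdorff_distance_def using that by (intro max.coboundedI1 SUP_upper)
  have 2: "dist_to edist v U \<le> hausdorff_distance U V" if "v \<in> V" for v
    unfolding hausdorff_distance_def using that by (intro max.coboundedI2 SUP_upper)
  obtain u where "u \<in> U" using \<open>U \<noteq> {}\<close> by blast
  have "V \<noteq> {}"
  proof
    assume "V = {}"
    then show False using 1[OF \<open>u \<in> U\<close>] less by (simp add: dist_to_def top_ereal_def)
  qed
  have "0 \<le> dist_to edist u V" unfolding dist_to_def edist_def by (rule INF_greatest) simp
  with 1[OF \<open>u \<in> U\<close>] have "0 \<le> hausdorff_distance U V" by simp
  with less obtain h where h: "hausdorff_distance U V = ereal h" "0 \<le> h" "h < \<epsilon>"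
    by (cases "hausdorff_distance U V") auto
  have "\<exists>v\<in>V. dist u v \<le> h" if "u \<in> U" for u
    using attained_dist_to[OF \<open>compact V\<close> \<open>V \<noteq> {}\<close>, of u h] 1[OF that] h(1) by metis
  moreover have "\<exists>u\<in>U. dist v u \<le> h" if "v \<in> V" for v
    using attained_dist_to[OF \<open>compact U\<close> \<open>U \<noteq> {}\<close>, of v h] 2[OF that] h(1) by metis
  ultimately show ?thesis using that h \<open>V \<noteq> {}\<close> by metis
qed

section \<open>Lipschitz estimate\<close>

theorem theorem5p1:
  fixes c :: "real ^ 'n" and b \<rho> :: real and U :: "(real ^ 'n) set"
  assumes "U \<noteq> {}" and "compact U" and "convex U"
    and "strong_Slater b U \<rho>"
    and "RO_opt c b U \<noteq> {}" and "bounded (RO_opt c b U)"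
  shows "lsio_of c b \<rho> U \<in> Pi_topology interior_of Pi_s \<and>
    (\<forall>\<epsilon>. 0 < \<epsilon> \<and>
         ereal \<epsilon> < dist_to delta_Pi (lsio_of c b \<rho> U) (Pi_topology frontier_of Pi_s) \<longrightarrow>
      (\<forall>V. compact V \<and> convex V \<and> hausdorff_distance U V < ereal \<epsilon> \<longrightarrow>
        \<bar>RO_value c b U - RO_value c b V\<bar>
          \<le> L_const (lsio_of c b \<rho> U) \<epsilon> * hausdorff_distance U V))"
proof (intro conjI allI impI)
  let ?\<pi> = "lsio_of c b \<rho> U"
  obtain x0 where "0 < \<rho>" and x0: "\<And>a. a \<in> U \<Longrightarrow> b + \<rho> \<le> a \<bullet> x0"
    using assms(4) by (auto simp: strong_Slater_def)
  obtain x1 where x1: "x1 \<in> RO_opt c b U" using assms(5) by blast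
  have int_Z: "0 \<in> interior (Z_minus ?\<pi>)"
    using zero_in_interior_Z_minus[OF assms(2) x1 assms(6)] .
  then obtain d0 where "0 < d0" "cball 0 d0 \<subseteq> Z_minus ?\<pi>" by (auto simp: mem_interior_cball)
  then show int_\<pi>: "?\<pi> \<in> Pi_topology interior_of Pi_s"
  proof (intro interior_Pi_s_if_Slater)
    show "snd (snd ?\<pi> t) + \<rho> \<le> fst (snd ?\<pi> t) \<bullet> x0" for t
      using x0[of t] by (simp add: lsio_of_def system_of_def)
    show "- (\<bar>b\<bar> + \<rho>) \<le> snd (snd ?\<pi> t)" for t
      using \<open>0 < \<rho>\<close> abs_ge_minus_self[of b] by (simp add: lsio_of_def system_of_def)
  qed (use \<open>0 < \<rho>\<close> in auto)

  fix \<epsilon> V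
  assume "0 < \<epsilon> \<and> ereal \<epsilon> < dist_to delta_Pi ?\<pi> (Pi_topology frontier_of Pi_s)"
  then have "0 < \<epsilon>" and \<epsilon>: "ereal \<epsilon> < dist_to delta_Pi ?\<pi> (Pi_topology frontier_of Pi_s)" by auto
  assume "compact V \<and> convex V \<and> hausdorff_distance U V < ereal \<epsilon>"
  then have V: "compact V" "convex V" "hausdorff_distance U V < ereal \<epsilon>" by auto
  obtain h where hd: "hausdorff_distance U V = ereal h" and h: "0 \<le> h" "h < \<epsilon>" and "V \<noteq> {}"
    and UV: "\<And>u. u \<in> U \<Longrightarrow> \<exists>v\<in>V. dist u v \<le> h" and VU: "\<And>v. v \<in> V \<Longrightarrow> \<exists>u\<in>U. dist v u \<le> h"
    using finite_hausdorff_distance[OF assms(2) V(1) assms(1) V(3)] by blast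
  have "?\<pi> \<in> Pi_s" using int_\<pi> by (rule subsetD[OF interior_of_subset])
  note \<epsilon>_less = less_le_trans[OF \<epsilon> dist_to_bd_Pi_s_le_dist_Sigma_i[OF this]]
    less_le_trans[OF \<epsilon> dist_to_bd_Pi_s_le_dist_bd_Z_minus[OF this]]

  have "compact (Z_minus ?\<pi>)"
    using assms(2) by (simp add: Z_minus_lsio_of compact_convex_hull)
  then obtain d where d: "dist_to edist 0 (frontier (Z_minus ?\<pi>)) = ereal d" "0 \<le> d" "cball 0 d \<subseteq> Z_minus ?\<pi>"
    using edist_0_frontier_inner_ball[OF _ subsetD[OF interior_subset int_Z]] by blast
  have "\<epsilon> < d" using \<epsilon>_less(2) d(1) by simp
  obtain u0 where "u0 \<in> U" using assms(1) by blast
  obtain D where D: "dist_to delta_Sigma (snd ?\<pi>) Sigma_i = ereal D"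
    using \<epsilon>_less(1) dist_Sigma_i_le_one_constraint[OF \<open>u0 \<in> U\<close>, of 1 b \<rho>]
    by (cases "dist_to delta_Sigma (snd ?\<pi>) Sigma_i") (auto simp: lsio_of_def)
  have "\<epsilon> < D" using \<epsilon>_less(1) D by simp
  have D': "ereal D \<le> dist_to delta_Sigma (system_of b \<rho> U) Sigma_i"
    using D by (simp add: lsio_of_def)

  define p where "p = c \<bullet> x1"
  have U_val: "RO_value c b U = ereal p" using x1 by (simp add: RO_opt_def p_def)
  define s where "s = max (- b) (max \<rho> p)"
  have Sup_R: "Sup (R_set ?\<pi>) = ereal s"
    using Sup_R_set_lsio_of[OF assms(2,1) _ U_val] \<open>0 < \<rho>\<close> by (simp add: s_def)
  have s: "- b \<le> s" "0 \<le> s" "p \<le> s" using \<open>0 < \<rho>\<close> by (auto simp: s_def)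
  obtain g m where "1 \<le> g" and m: "m = (s + \<epsilon> * g) / (d - \<epsilon>)"
    and L: "L_const ?\<pi> \<epsilon> = ereal ((\<epsilon> + norm (fst ?\<pi>)) * ((1 + m) * sqrt (1 + m\<^sup>2) / (D - \<epsilon>)) + m)"
    using L_const_real[OF Sup_R d(1) D _ less_imp_neq[OF \<open>\<epsilon> < d\<close>, symmetric] less_imp_neq[OF \<open>\<epsilon> < D\<close>, symmetric]]
      \<open>0 < \<epsilon>\<close> \<open>\<epsilon> < d\<close> by auto
  define l where "l = norm c * ((1 + m) * sqrt (1 + m\<^sup>2) / (D - \<epsilon>))"
  have "s / (d - \<epsilon>) \<le> m"
    using \<open>0 < \<epsilon>\<close> \<open>\<epsilon> < d\<close> \<open>1 \<le> g\<close> by (simp add: m divide_right_mono)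
  have "0 \<le> m" using s \<open>0 < \<epsilon>\<close> \<open>\<epsilon> < d\<close> \<open>1 \<le> g\<close> by (simp add: m)
  have "0 \<le> (1 + m) * sqrt (1 + m\<^sup>2) / (D - \<epsilon>)" using \<open>0 \<le> m\<close> \<open>\<epsilon> < D\<close> by simp
  then have "l \<le> (\<epsilon> + norm c) * ((1 + m) * sqrt (1 + m\<^sup>2) / (D - \<epsilon>))"
    unfolding l_def using \<open>0 < \<epsilon>\<close> by (intro mult_right_mono) auto
  then have "l \<le> (\<epsilon> + norm c) * ((1 + m) * sqrt (1 + m\<^sup>2) / (D - \<epsilon>)) + m"
    using \<open>0 \<le> m\<close> by linarith
  then obtain l' where l': "L_const ?\<pi> \<epsilon> = ereal l'" "l \<le> l'" using L by (auto simp: lsio_of_def)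
  \<comment> \<open>This covers an optimal point for \<open>U\<close> as well as the feasible points for \<open>V\<close> that cost at most \<open>p\<close>;
    the term \<open>h * norm x\<close> turns the denominator \<open>d\<close> into \<open>d - h\<close>, which exceeds \<open>d - \<epsilon>\<close>.\<close>
  have norm_le: "norm x \<le> m" if x: "\<And>u. u \<in> U \<Longrightarrow> b - h * norm x \<le> u \<bullet> x" "c \<bullet> x \<le> p" for x
  proof -
    have "d * norm x \<le> s + h * norm x"
    proof (rule norm_bound_from_inner_ball[OF _ d(2)])
      show "cball 0 d \<subseteq> convex hull (insert 0 (insert (- c) U))"
        using d(3) by (simp add: Z_minus_lsio_of[OF assms(2)])
      have "0 \<le> h * norm x" using h by simp
      then show "- (s + h * norm x) \<le> z \<bullet> x" if "z \<in> insert 0 (insert (- c) U)" for z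
        using that s x(2) x(1)[of z] by auto
    qed
    then have "norm x * (d - \<epsilon>) + norm x * (\<epsilon> - h) \<le> s" by (simp add: algebra_simps)
    moreover have "0 \<le> norm x * (\<epsilon> - h)" using h by simp
    ultimately have "norm x \<le> s / (d - \<epsilon>)" using \<open>\<epsilon> < d\<close> by (simp add: field_simps)
    with \<open>s / (d - \<epsilon>) \<le> m\<close> show ?thesis by simp
  qed
  have residual: "b - h * norm x \<le> v \<bullet> x" if "b \<le> u \<bullet> x" "dist u v \<le> h" for u v x :: "real ^ 'n"
  proof -
    have "(u - v) \<bullet> x \<le> norm (u - v) * norm x" by (rule norm_cauchy_schwarz)
    also have "\<dots> \<le> h * norm x" using that(2) by (simp add: dist_norm mult_right_mono)
    finally show ?thesis using that(1) by (simp add: inner_diff_left)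
  qed

  have upper: "RO_value c b V \<le> ereal (p + l * h)"
    unfolding p_def l_def
  proof (rule RO_value_le_near_feasible[OF D' h \<open>\<epsilon> < D\<close> V(1,2) \<open>V \<noteq> {}\<close>])
    have x1_feas: "b \<le> u \<bullet> x1" if "u \<in> U" for u using x1 that by (simp add: RO_opt_def RO_feasible_def)
    show "\<exists>u\<in>U. norm (u - v) \<le> h" if "v \<in> V" for v
      using VU[OF that] by (simp add: dist_norm norm_minus_commute)
    show "b - h * norm x1 \<le> v \<bullet> x1" if "v \<in> V" for v
      using VU[OF that] x1_feas residual by (metis dist_commute)
    show "norm x1 \<le> m"
      using residual[OF x1_feas] h by (intro norm_le) (auto simp: p_def)
  qed
  have lower: "ereal (p - l * h) \<le> RO_value c b V"
    unfolding RO_value_def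
  proof (rule INF_greatest)
    fix x assume x: "x \<in> RO_feasible b V"
    have "0 \<le> l" using \<open>0 \<le> m\<close> \<open>\<epsilon> < D\<close> by (simp add: l_def)
    show "ereal (p - l * h) \<le> ereal (c \<bullet> x)"
    proof (cases "c \<bullet> x \<le> p")
      case False
      then show ?thesis using mult_nonneg_nonneg[OF \<open>0 \<le> l\<close> h(1)] by simp
    next
      case True
      have res: "b - h * norm x \<le> u \<bullet> x" if u: "u \<in> U" for u
        using UV[OF u] x residual by (metis (mono_tags, lifting) RO_feasible_def dist_commute mem_Collect_eq)
      have "RO_value c b U \<le> ereal (c \<bullet> x + l * h)"
        unfolding l_def
      proof (rule RO_value_le_near_feasible[OF D' h \<open>\<epsilon> < D\<close> assms(2,3,1)])
        show "\<exists>u'\<in>U. norm (u' - u) \<le> h" if "u \<in> U" for u using that h by (intro bexI[of _ u]) auto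
      qed (use res norm_le True in auto)
      then show ?thesis by (simp add: U_val)
    qed
  qed
  obtain q where q: "RO_value c b V = ereal q" using upper lower by (cases "RO_value c b V") auto
  have "\<bar>p - q\<bar> \<le> l * h" using upper lower unfolding q by auto
  also have "\<dots> \<le> l' * h" using l'(2) h(1) by (rule mult_right_mono)
  finally show "\<bar>RO_value c b U - RO_value c b V\<bar> \<le> L_const ?\<pi> \<epsilon> * hausdorff_distance U V"
    by (simp add: U_val q l'(1) hd)
qed

end
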